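(* Let $n\in\mathbb N_0$, let $\lambda\in\mathbb C$ with $\lambda+n+1\notin\{0,-1,-2,\ldots\}$, and let $x\in(-1,1)$. Then $$P_n^{(\lambda,-\frac12)}(2x^2-1)=\frac{2^\lambda\,\Gamma(\lambda+n+1)}{n!\,(1-x^2)^{\frac{\lambda}{2}}}\,{\sf P}_{2n+\lambda}^{-\lambda}(x).$$
   Context: $\mathbb N_0=\{0,1,2,\ldots\}$. The Pochhammer symbol is $(a)_0=1$, $(a)_k=a(a+1)\cdots(a+k-1)$. The Jacobi polynomial is $P_n^{(\alpha,\beta)}(y)=\frac{(\alpha+1)_n}{n!}\,{}_2F_1\left(-n,n+\alpha+\beta+1;\alpha+1;\frac{1-y}{2}\right)$, a polynomial in $y$, $\alpha$ and $\beta$ (extended by continuity in $\alpha$ where $\alpha+1\in\{0,-1,-2,\ldots\}$). The Ferrers function of the first kind is, for $\nu,\mu\in\mathbb C$ and $x\in(-1,1)$, $${\sf P}_\nu^{-\mu}(x)=\frac{1}{\Gamma(\mu+1)}\left(\frac{1-x}{1+x}\right)^{\frac{\mu}{2}}{}_2F_1\left(-\nu,\nu+1;\mu+1;\frac{1-x}{2}\right)=\left(\frac{1-x}{1+x}\right)^{\frac{\mu}{2}}\sum_{k=0}^\infty\frac{(-\nu)_k(\nu+1)_k}{\Gamma(\mu+1+k)\,k!}\left(\frac{1-x}{2}\right)^k,$$ where $1/\Gamma$ is the entire reciprocal gamma function. Here ${}_2F_1(a,b;c;z)=\sum_{k\ge0}\frac{(a)_k(b)_k}{(c)_k}\frac{z^k}{k!}$.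 Powers of positive reals are principal. *)

theory Defs
  imports "HOL-Analysis.Analysis"
begin

definition hyp2F1 :: "complex \<Rightarrow> complex \<Rightarrow> complex \<Rightarrow> complex \<Rightarrow> complex" where
  "hyp2F1 a b c z = eval_fps (fps_hypergeo [a, b] [c] 1) z"

lemma hyp2F1_series:
  "hyp2F1 a b c z =
     (\<Sum>k. pochhammer a k * pochhammer b k / pochhammer c k * (z ^ k / fact k))"
  by (simp add: hyp2F1_def eval_fps_def)

lemma summable_hyp2F1:
  assumes "norm (z :: complex) < 1"
  shows "summable (\<lambda>k. pochhammer a k * pochhammer b k / pochhammer c k * (z ^ k / fact k))"
proof -
  let ?t = "\<lambda>k. pochhammer a k * pochhammer b k / pochhammer c k * (z ^ k / fact k)"
  let ?r = "\<lambda>k. (a + of_nat k) / (c + of_nat k) * ((b + of_nat k) / (1 + of_nat k)) * z"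
  have 1: "(\<lambda>k. (u + of_nat k) / (v + of_nat k)) \<longlonglongrightarrow> 1" for u v :: complex
  proof -
    have inf: "filterlim (\<lambda>k. v + of_nat k) at_infinity sequentially"
      by (rule tendsto_add_filterlim_at_infinity[OF tendsto_const tendsto_of_nat])
    have "(\<lambda>k. 1 + (u - v) / (v + of_nat k)) \<longlonglongrightarrow> 1 + 0"
      by (rule tendsto_add[OF tendsto_const tendsto_divide_0[OF tendsto_const inf]])
    moreover have "\<forall>\<^sub>F k in sequentially. v + of_nat k \<noteq> 0"
      using inf by (rule filterlim_at_infinity_imp_eventually_ne)
    hence "\<forall>\<^sub>F k in sequentially. 1 + (u - v) / (v + of_nat k) = (u + of_nat k) / (v + of_nat k)"
      by eventually_elim (simp add: field_simps)
    ultimately show ?thesis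
      by (auto intro: Lim_transform_eventually)
  qed
  have "(\<lambda>k. norm (?r k)) \<longlonglongrightarrow> norm (1 * 1 * z)"
    by (intro tendsto_intros 1)
  moreover obtain d where d: "norm z < d" "d < 1"
    using assms dense by blast
  ultimately have "\<forall>\<^sub>F k in sequentially. norm (?r k) < d"
    by (intro order_tendstoD(2)) auto
  then obtain N where N: "norm (?r k) < d" if "k \<ge> N" for k
    by (auto simp: eventually_sequentially)
  show ?thesis
  proof (rule summable_ratio_test[OF d(2)])
    fix k assume "k \<ge> N"
    have "?t (Suc k) = ?r k * ?t k"
      by (simp add: pochhammer_Suc field_simps)
    hence "norm (?t (Suc k)) = norm (?r k) * norm (?t k)"
      by (simp only: norm_mult)
    also have "\<dots> \<le> d * norm (?t k)"
      using N[OF \<open>k \<ge> N\<close>] by (intro mult_right_mono) auto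
    finally show "norm (?t (Suc k)) \<le> d * norm (?t k)" .
  qed
qed

definition jacobi_raw :: "nat \<Rightarrow> complex \<Rightarrow> complex \<Rightarrow> complex \<Rightarrow> complex" where
  "jacobi_raw n \<alpha> \<beta> y =
     pochhammer (\<alpha> + 1) n / fact n *
     hyp2F1 (- of_nat n) (of_nat n + \<alpha> + \<beta> + 1) (\<alpha> + 1) ((1 - y) / 2)"

text \<open>
  The hypergeometric formula is meaningless at \<open>\<alpha> + 1 \<in> \<int>\<^sub>\<le>\<^sub>0\<close>, where the Jacobi polynomial
  is obtained by continuity in \<open>\<alpha>\<close>. The limit exists: see \<open>jacobi_P_eq_sum\<close> and
  \<open>tendsto_jacobi_raw\<close> below.
\<close>

definition jacobi_P :: "nat \<Rightarrow> complex \<Rightarrow> complex \<Rightarrow> complex \<Rightarrow> complex" where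
  "jacobi_P n \<alpha> \<beta> y =
     (if \<alpha> + 1 \<in> \<int>\<^sub>\<le>\<^sub>0 then Lim (at \<alpha>) (\<lambda>a. jacobi_raw n a \<beta> y)
      else jacobi_raw n \<alpha> \<beta> y)"

text \<open>
  \<open>ferrers_P \<nu> m x\<close> is the Ferrers function of the first kind of degree \<open>\<nu>\<close> and order \<open>m\<close>,
  i.e. \<open>P\<^sub>\<nu>\<^sup>m(x)\<close>; the formula for \<open>P\<^sub>\<nu>\<^sup>-\<^sup>\<mu>(x)\<close> is the one below with \<open>m = -\<mu>\<close>. The factor
  \<open>rGamma\<close> is kept inside the sum so that every complex order is covered.
\<close>

definition ferrers_P :: "complex \<Rightarrow> complex \<Rightarrow> real \<Rightarrow> complex" where
  "ferrers_P \<nu> m x =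
     (let \<mu> = - m in
        of_real ((1 - x) / (1 + x)) powr (\<mu> / 2) *
        (\<Sum>k. pochhammer (- \<nu>) k * pochhammer (\<nu> + 1) k * rGamma (\<mu> + 1 + of_nat k) / fact k *
              (of_real ((1 - x) / 2)) ^ k))"

lemma jacobi_raw_eq_sum:
  assumes "\<alpha> + 1 \<notin> \<int>\<^sub>\<le>\<^sub>0"
  shows "jacobi_raw n \<alpha> \<beta> y =
    (\<Sum>k\<le>n. pochhammer (- of_nat n) k * pochhammer (of_nat n + \<alpha> + \<beta> + 1) k *
            pochhammer (\<alpha> + 1 + of_nat k) (n - k) / (fact n * fact k) * ((1 - y) / 2) ^ k)"
proof -
  let ?t = "\<lambda>k. pochhammer (- of_nat n) k * pochhammer (of_nat n + \<alpha> + \<beta> + 1) k /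
                 pochhammer (\<alpha> + 1) k * (((1 - y) / 2) ^ k / fact k)"
  have "hyp2F1 (- of_nat n) (of_nat n + \<alpha> + \<beta> + 1) (\<alpha> + 1) ((1 - y) / 2) = (\<Sum>k\<le>n. ?t k)"
    unfolding hyp2F1_series
    by (rule suminf_finite) (auto simp: pochhammer_of_nat_eq_0_iff)
  moreover have "pochhammer (\<alpha> + 1) n / fact n * ?t k =
      pochhammer (- of_nat n) k * pochhammer (of_nat n + \<alpha> + \<beta> + 1) k *
      pochhammer (\<alpha> + 1 + of_nat k) (n - k) / (fact n * fact k) * ((1 - y) / 2) ^ k"
    if "k \<le> n" for k
  proof -
    have "pochhammer (\<alpha> + 1) k \<noteq> 0"
      using assms by (auto simp: pochhammer_eq_0_iff)
    thus ?thesis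
      by (subst pochhammer_product[OF that]) (simp add: field_simps)
  qed
  ultimately show ?thesis
    by (simp add: jacobi_raw_def sum_distrib_left)
qed

lemma tendsto_jacobi_raw:
  "((\<lambda>a. jacobi_raw n a \<beta> y) \<longlongrightarrow>
    (\<Sum>k\<le>n. pochhammer (- of_nat n) k * pochhammer (of_nat n + \<alpha> + \<beta> + 1) k *
            pochhammer (\<alpha> + 1 + of_nat k) (n - k) / (fact n * fact k) * ((1 - y) / 2) ^ k))
   (at \<alpha>)"
proof -
  let ?F = "\<lambda>a. \<Sum>k\<le>n. pochhammer (- of_nat n) k * pochhammer (of_nat n + a + \<beta> + 1) k *
            pochhammer (a + 1 + of_nat k) (n - k) / (fact n * fact k) * ((1 - y) / 2) ^ k"
  have "\<not> \<alpha> islimpt {a. a + 1 \<in> \<int>\<^sub>\<le>\<^sub>0}"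
  proof (rule discrete_imp_not_islimpt[of 1])
    fix a b :: complex
    assume "a \<in> {a. a + 1 \<in> \<int>\<^sub>\<le>\<^sub>0}" "b \<in> {a. a + 1 \<in> \<int>\<^sub>\<le>\<^sub>0}" and lt: "dist b a < 1"
    then obtain i j :: int where ij: "a + 1 = of_int i" "b + 1 = of_int j"
      by (auto elim!: nonpos_Ints_cases)
    have "dist b a = dist (b + 1) (a + 1)"
      by simp
    also have "\<dots> = of_int \<bar>j - i\<bar>"
      unfolding ij by (simp add: dist_of_int)
    finally have "i = j"
      using lt by simp
    thus "b = a"
      using ij by (metis add_right_cancel)
  qed simp
  hence "\<forall>\<^sub>F a in at \<alpha>. a + 1 \<notin> \<int>\<^sub>\<le>\<^sub>0"
    by (simp add: islimpt_iff_eventually)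
  hence ev: "\<forall>\<^sub>F a in at \<alpha>. ?F a = jacobi_raw n a \<beta> y"
    by eventually_elim (simp add: jacobi_raw_eq_sum)
  have "?F holomorphic_on UNIV"
    by (intro holomorphic_intros) auto
  hence "isCont ?F \<alpha>"
    using holomorphic_on_imp_continuous_on continuous_on_eq_continuous_at[of UNIV ?F] by blast
  thus ?thesis
    using ev by (auto simp: isCont_def intro: Lim_transform_eventually)
qed

lemma jacobi_P_eq_sum:
  "jacobi_P n \<alpha> \<beta> y =
    (\<Sum>k\<le>n. pochhammer (- of_nat n) k * pochhammer (of_nat n + \<alpha> + \<beta> + 1) k *
            pochhammer (\<alpha> + 1 + of_nat k) (n - k) / (fact n * fact k) * ((1 - y) / 2) ^ k)"
  using tendsto_Lim[OF _ tendsto_jacobi_raw] by (simp add: jacobi_P_def jacobi_raw_eq_sum)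

lemma ferrers_P_hyp2F1:
  assumes "\<mu> + 1 \<notin> \<int>\<^sub>\<le>\<^sub>0" "-1 < x" "x < 1"
  shows "ferrers_P \<nu> (- \<mu>) x =
    1 / Gamma (\<mu> + 1) * of_real ((1 - x) / (1 + x)) powr (\<mu> / 2) *
    hyp2F1 (- \<nu>) (\<nu> + 1) (\<mu> + 1) (of_real ((1 - x) / 2))"
proof -
  define z where "z = complex_of_real ((1 - x) / 2)"
  let ?t = "\<lambda>k. pochhammer (- \<nu>) k * pochhammer (\<nu> + 1) k / pochhammer (\<mu> + 1) k * (z ^ k / fact k)"
  have eq: "pochhammer (- \<nu>) k * pochhammer (\<nu> + 1) k * rGamma (\<mu> + 1 + of_nat k) / fact k * z ^ k =
      rGamma (\<mu> + 1) * ?t k" for k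
  proof -
    have "pochhammer (\<mu> + 1) k \<noteq> 0"
      using assms(1) by (auto simp: pochhammer_eq_0_iff)
    thus ?thesis
      by (subst pochhammer_rGamma[of "\<mu> + 1" k]) (simp add: field_simps)
  qed
  have "norm z < 1"
    using assms(2,3) unfolding z_def norm_of_real by simp
  hence "summable ?t"
    by (rule summable_hyp2F1)
  hence "(\<Sum>k. rGamma (\<mu> + 1) * ?t k) = rGamma (\<mu> + 1) * (\<Sum>k. ?t k)"
    by (rule suminf_mult)
  thus ?thesis
    unfolding ferrers_P_def Let_def minus_minus hyp2F1_series z_def[symmetric] eq
    by (simp add: rGamma_inverse_Gamma field_simps)
qed

end

theory Submission
  imports Defs
begin

text \<open>
  Let \<open>F(a,b;c;z)\<close> denote the regularised hypergeometric series
  \<open>\<Sum>k. (a)\<^sub>k (b)\<^sub>k z\<^sup>k / (\<Gamma>(c+k) k!)\<close>, which for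
  \<open>\<bar>z\<bar> < 1\<close> is entire in \<open>a\<close>, \<open>b\<close> and \<open>c\<close>. With
  \<open>z = (1-x)/2\<close>, so that \<open>4z(1-z) = 1-x\<^sup>2\<close>, the left-hand side is a multiple of
  \<open>F(-n, n+\<lambda>+1/2; \<lambda>+1; 4z(1-z))\<close> and the right-hand side a multiple of
  \<open>F(-2n-\<lambda>, 2n+\<lambda>+1; \<lambda>+1; z)\<close>. Two classical transformations link them:
  the Euler transformation (\<open>reg_hyp_Euler\<close>)
  \[ F(c-a,c-b;c;z) = (1-z)^{a+b-c}\, F(a,b;c;z), \]
  which turns the second series into \<open>(1-z)\<^sup>\<lambda> F(-2n, 2n+2\<lambda>+1; \<lambda>+1; z)\<close>, and Gauss's quadratic
  transformation (\<open>reg_hyp_quadratic\<close>)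
  \[ F(2a,2b;a+b+\frac12;z) = F(a,b;a+b+\frac12;4z(1-z)) \]
  with \<open>a = -n\<close>. What then remains is to compare powers of \<open>1-x\<close>, \<open>1+x\<close> and \<open>2\<close>.

  Both transformations are proved as identities of formal power series. If \<open>c\<close> is not a
  nonpositive integer, a formal solution of the hypergeometric differential equation is determined
  by its constant term (\<open>hyp_ode_unique\<close>), and either side solves the same equation. For
  \<open>c\<close> a nonpositive integer uniqueness fails, but each coefficient of the two sides is
  continuous in \<open>c\<close>, so the identities persist; this is why the regularised series is used.
  For \<open>a = -n\<close> the series \<open>F(a,b;c)\<close> is a polynomial, so evaluating the quadratic
  transformation raises no question of convergence and the result holds for negative \<open>x\<close> too.
\<close>

unbundle no vec_syntax and fps_syntax


section \<open>The hypergeometric differential equation for formal power series\<close>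

text \<open>
  \<open>F\<close> is a formal solution of \<open>X (1 - X) F'' + (c - (a + b + 1) X) F' - a b F = 0\<close>.
\<close>

definition hyp_ode :: "'a::field_char_0 \<Rightarrow> 'a \<Rightarrow> 'a \<Rightarrow> 'a fps \<Rightarrow> bool" where
  "hyp_ode a b c F \<longleftrightarrow>
     fps_X * (1 - fps_X) * fps_deriv (fps_deriv F)
       + (fps_const c - fps_const (a + b + 1) * fps_X) * fps_deriv F - fps_const (a * b) * F = 0"

text \<open>
  Comparing coefficients of \<open>X\<^sup>k\<close> turns the equation into the two-term recurrence satisfied by the
  hypergeometric coefficients.
\<close>

lemma hyp_ode_iff:
  "hyp_ode a b c F \<longleftrightarrow>
     (\<forall>k. of_nat (Suc k) * (c + of_nat k) * F $ Suc k = (a + of_nat k) * (b + of_nat k) * F $ k)"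
proof -
  have "(fps_X * (1 - fps_X) * fps_deriv (fps_deriv F)
       + (fps_const c - fps_const (a + b + 1) * fps_X) * fps_deriv F - fps_const (a * b) * F) $ k =
     of_nat (Suc k) * (c + of_nat k) * F $ Suc k - (a + of_nat k) * (b + of_nat k) * F $ k" for k
  proof -
    have "(fps_X * (1 - fps_X) * fps_deriv (fps_deriv F)
       + (fps_const c - fps_const (a + b + 1) * fps_X) * fps_deriv F - fps_const (a * b) * F) =
       fps_X * fps_deriv (fps_deriv F) - fps_X * (fps_X * fps_deriv (fps_deriv F))
       + fps_const c * fps_deriv F - fps_const (a + b + 1) * (fps_X * fps_deriv F) - fps_const (a * b) * F"
      by (simp add: algebra_simps)
    thus ?thesis
      by (cases k; cases "k - 1") (simp_all add: algebra_simps)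
  qed
  thus ?thesis
    unfolding hyp_ode_def fps_eq_iff by simp
qed

lemma hyp_ode_unique:
  fixes c :: complex
  assumes "hyp_ode a b c F" "hyp_ode a b c G" "F $ 0 = G $ 0" "c \<notin> \<int>\<^sub>\<le>\<^sub>0"
  shows "F = G"
proof (rule fps_ext)
  fix k
  show "F $ k = G $ k"
  proof (induction k)
    case (Suc k)
    have "c + of_nat k \<noteq> 0"
      using assms(4) plus_of_nat_eq_0_imp by blast
    hence "of_nat (Suc k) * (c + of_nat k) \<noteq> 0"
      by (simp del: of_nat_Suc)
    moreover have "of_nat (Suc k) * (c + of_nat k) * F $ Suc k = of_nat (Suc k) * (c + of_nat k) * G $ Suc k"
      using assms(1,2) Suc by (simp only: hyp_ode_iff)
    ultimately show ?case
      by (metis mult_left_cancel)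
  qed (fact assms)
qed

text \<open>
  The hypothesis on \<open>U\<close> says that \<open>U\<close> is a multiple of \<open>(1 - X)\<close> to the power \<open>a + b - c\<close>.
\<close>

lemma hyp_ode_binomial_mult:
  fixes U F :: "complex fps"
  assumes U: "(1 - fps_X) * fps_deriv U = - (fps_const (a + b - c) * U)"
    and F: "hyp_ode a b c F"
  shows "hyp_ode (c - a) (c - b) c (U * F)"
proof -
  define A B C where "A = fps_const a" and "B = fps_const b" and "C = fps_const c"
  define E where "E = A + B - C"
  define U' U'' F' F'' where "U' = fps_deriv U" and "U'' = fps_deriv U'"
    and "F' = fps_deriv F" and "F'' = fps_deriv F'"
  let ?X = "fps_X :: complex fps"
  have c: "fps_const (a + b - c) = E" "fps_const (c - a) = C - A" "fps_const (c - b) = C - B"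
    by (simp_all add: A_def B_def C_def E_def)
  have params: "fps_const (c - a + (c - b) + 1) = (C - A) + (C - B) + 1"
      "fps_const ((c - a) * (c - b)) = (C - A) * (C - B)"
    by (simp_all add: A_def B_def C_def flip: fps_const_1_eq_1)
  have d: "fps_deriv (U * F) = U' * F + U * F'"
      "fps_deriv (U' * F + U * F') = U'' * F + 2 * U' * F' + U * F''"
    by (simp_all add: U'_def U''_def F'_def F''_def algebra_simps)
  have 1: "(1 - ?X) * U' = - E * U"
    using U unfolding U'_def c by simp
  have "fps_deriv ((1 - ?X) * U') = fps_deriv (- E * U)"
    using 1 by simp
  moreover have "fps_deriv ((1 - ?X) * U') = (1 - ?X) * U'' - U'"
    by (simp add: U''_def algebra_simps)
  moreover have "fps_deriv (- E * U) = - E * U'"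
    unfolding c(1)[symmetric] U'_def by simp
  ultimately have "(1 - ?X) * U'' - U' = - E * U'"
    by metis
  hence 2: "(1 - ?X) * U'' = U' - E * U'"
    by (simp add: diff_eq_eq)
  have 3: "?X * (1 - ?X) * F'' + (C - (A + B + 1) * ?X) * F' - A * B * F = 0"
    using F by (simp add: hyp_ode_def A_def B_def C_def F'_def F''_def
        flip: fps_const_add fps_const_mult)
  \<comment> \<open>The extra factor \<open>1 - X\<close> allows \<open>U'\<close> and \<open>U''\<close> to be eliminated using the equation for \<open>U\<close>.\<close>
  have "(1 - ?X) * (?X * (1 - ?X) * (U'' * F + 2 * U' * F' + U * F'')
      + (C - ((C - A) + (C - B) + 1) * ?X) * (U' * F + U * F') - (C - A) * (C - B) * (U * F)) = 0"
    using 1 2 3 unfolding E_def by algebra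
  moreover have "1 - ?X \<noteq> 0"
    by (metis fps_X_neq_one right_minus_eq)
  ultimately have "?X * (1 - ?X) * (U'' * F + 2 * U' * F' + U * F'')
      + (C - ((C - A) + (C - B) + 1) * ?X) * (U' * F + U * F') - (C - A) * (C - B) * (U * F) = 0"
    by (metis mult_eq_0_iff)
  thus ?thesis
    unfolding hyp_ode_def d params C_def[symmetric] .
qed

text \<open>The series \<open>fps_binomial e oo (- fps_X)\<close> is the formal power \<open>(1 - X)\<^sup>e\<close>.\<close>

lemma fps_deriv_one_minus_powr:
  fixes e :: "'a :: field_char_0"
  shows "(1 - fps_X) * fps_deriv (fps_binomial e oo (- fps_X)) =
    - (fps_const e * (fps_binomial e oo (- fps_X)))"
proof -
  have "(1 + fps_X) * fps_deriv (fps_binomial e) = fps_const e * fps_binomial e"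
    by (simp add: fps_binomial_deriv fps_divide_unit mult_ac inverse_mult_eq_1')
  hence "((1 + fps_X) * fps_deriv (fps_binomial e)) oo (- fps_X) =
      (fps_const e * fps_binomial e) oo (- fps_X)"
    by simp
  hence "(1 - fps_X) * (fps_deriv (fps_binomial e) oo (- fps_X)) =
      fps_const e * (fps_binomial e oo (- fps_X))"
    by (simp add: fps_compose_mult_distrib fps_compose_add_distrib)
  thus ?thesis
    by (simp add: fps_compose_deriv)
qed

lemma hyp_ode_quadratic:
  fixes a b :: "'a :: field_char_0"
  assumes F: "hyp_ode a b (a + b + 1/2) F"
  shows "hyp_ode (2 * a) (2 * b) (a + b + 1/2) (F oo (4 * fps_X * (1 - fps_X)))"
proof -
  let ?X = "fps_X :: 'a fps"
  define t where "t = 4 * ?X * (1 - ?X)"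
  define A B C where "A = fps_const a" and "B = fps_const b" and "C = fps_const (a + b + 1/2)"
  define G0 G1 G2 where "G0 = F oo t" and "G1 = fps_deriv F oo t" and "G2 = fps_deriv (fps_deriv F) oo t"
  have t0: "t $ 0 = 0" by (simp add: t_def)
  have dt: "fps_deriv t = 4 - 8 * ?X"
    by (simp add: t_def algebra_simps)
  have d0: "fps_deriv G0 = G1 * (4 - 8 * ?X)" and d1: "fps_deriv G1 = G2 * (4 - 8 * ?X)"
    by (simp_all add: G0_def G1_def G2_def fps_compose_deriv t0 dt)
  have d2: "fps_deriv (fps_deriv G0) = G2 * (4 - 8 * ?X) ^ 2 - 8 * G1"
    by (simp add: d0 d1 power2_eq_square algebra_simps)
  have c: "fps_const (2 * a + 2 * b + 1) = 2 * A + 2 * B + 1" "fps_const (2 * a * (2 * b)) = 2 * A * (2 * B)"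
    by (simp_all add: A_def B_def numeral_fps_const flip: fps_const_1_eq_1)
  \<comment> \<open>The only place where the special value \<open>c = a + b + 1/2\<close> enters: it makes all first-order
    terms multiples of \<open>F'(t)\<close> with a coefficient that is a function of \<open>t\<close> alone.\<close>
  have C: "2 * C = 2 * A + 2 * B + 1"
    by (simp add: C_def A_def B_def numeral_fps_const algebra_simps flip: fps_const_1_eq_1)
  have "(fps_X * (1 - fps_X) * fps_deriv (fps_deriv F)
       + (C - (A + B + 1) * fps_X) * fps_deriv F - A * B * F) oo t = 0 oo t"
    using F by (simp add: hyp_ode_def A_def B_def C_def flip: fps_const_add fps_const_mult)
  hence "t * (1 - t) * G2 + (C - (A + B + 1) * t) * G1 - A * B * G0 = 0"
    by (simp add: fps_compose_mult_distrib fps_compose_add_distrib fps_compose_sub_distrib t0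
        G0_def G1_def G2_def A_def B_def C_def)
  hence "?X * (1 - ?X) * (G2 * (4 - 8 * ?X) ^ 2 - 8 * G1)
      + (C - (2 * A + 2 * B + 1) * ?X) * (G1 * (4 - 8 * ?X)) - 2 * A * (2 * B) * G0 = 0"
    using C unfolding t_def by algebra
  thus ?thesis
    unfolding hyp_ode_def t_def[symmetric] G0_def[symmetric] c C_def[symmetric] d2
    unfolding d0 .
qed


section \<open>Transformations of the regularised hypergeometric series\<close>

text \<open>
  The power series of \<open>\<^sub>2F\<^sub>1(a,b;c;z) / \<Gamma>(c)\<close>. The reciprocal Gamma function is kept inside the
  coefficients, so that \<open>c\<close> may be a nonpositive integer.
\<close>

definition reg_hyp :: "complex \<Rightarrow> complex \<Rightarrow> complex \<Rightarrow> complex fps" where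
  "reg_hyp a b c = Abs_fps (\<lambda>k. pochhammer a k * pochhammer b k * rGamma (c + of_nat k) / fact k)"

lemma reg_hyp_nth:
  "reg_hyp a b c $ k = pochhammer a k * pochhammer b k * rGamma (c + of_nat k) / fact k"
  by (simp add: reg_hyp_def)

lemma reg_hyp_commute: "reg_hyp a b c = reg_hyp b a c"
  by (simp add: reg_hyp_def mult_ac)

lemma hyp_ode_reg_hyp: "hyp_ode a b c (reg_hyp a b c)"
  unfolding hyp_ode_iff
proof
  fix k
  have "rGamma (c + of_nat k) = (c + of_nat k) * rGamma (c + of_nat (Suc k))"
    using rGamma_plus1[of "c + of_nat k"] by (simp add: add_ac)
  thus "of_nat (Suc k) * (c + of_nat k) * reg_hyp a b c $ Suc k =
        (a + of_nat k) * (b + of_nat k) * reg_hyp a b c $ k"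
    by (simp add: reg_hyp_nth pochhammer_Suc field_simps del: of_nat_Suc)
qed

lemma eq_if_eq_off_nonpos_Ints:
  fixes f g :: "complex \<Rightarrow> complex"
  assumes "continuous_on UNIV f" "continuous_on UNIV g" "\<And>z. z \<notin> \<int>\<^sub>\<le>\<^sub>0 \<Longrightarrow> f z = g z"
  shows "f z = g z"
proof -
  have "countable (\<int>\<^sub>\<le>\<^sub>0 :: complex set)"
    by (rule countable_subset[of _ "range of_int"]) (auto elim!: nonpos_Ints_cases)
  hence "interior (\<int>\<^sub>\<le>\<^sub>0 :: complex set) = {}"
    by (metis countable_subset equals0I mem_interior uncountable_ball)
  hence "z \<in> closure (- \<int>\<^sub>\<le>\<^sub>0)"
    by (simp add: closure_interior)
  moreover have "continuous_on (closure (- \<int>\<^sub>\<le>\<^sub>0)) (\<lambda>z. f z - g z)"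
    using assms(1,2) by (intro continuous_intros) (auto intro: continuous_on_subset)
  ultimately show ?thesis
    using assms(3) continuous_constant_on_closure[of "- \<int>\<^sub>\<le>\<^sub>0" "\<lambda>z. f z - g z" 0 z] by simp
qed

lemmas continuous_on_rGamma' = continuous_on_compose2[OF continuous_on_rGamma _ subset_UNIV]

text \<open>Euler's transformation, valid for all complex parameters.\<close>

lemma reg_hyp_Euler:
  "(fps_binomial (a + b - c) oo (- fps_X)) * reg_hyp a b c = reg_hyp (c - a) (c - b) c"
proof (rule fps_ext)
  fix k
  let ?L = "\<lambda>c. ((fps_binomial (a + b - c) oo (- fps_X)) * reg_hyp a b c) $ k"
  let ?R = "\<lambda>c. reg_hyp (c - a) (c - b) c $ k"
  show "?L c = ?R c"
  proof (rule eq_if_eq_off_nonpos_Ints[of ?L ?R])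
    show "continuous_on UNIV ?L"
      by (simp add: fps_mult_nth fps_compose_uminus' reg_hyp_nth gbinomial_pochhammer)
         (intro continuous_intros continuous_on_rGamma'; simp)
    show "continuous_on UNIV ?R"
      unfolding reg_hyp_nth by (intro continuous_intros continuous_on_rGamma'; simp)
    show "?L c = ?R c" if "c \<notin> \<int>\<^sub>\<le>\<^sub>0" for c
    proof -
      have "(fps_binomial (a + b - c) oo (- fps_X)) * reg_hyp a b c = reg_hyp (c - a) (c - b) c"
        using hyp_ode_binomial_mult[OF fps_deriv_one_minus_powr hyp_ode_reg_hyp] hyp_ode_reg_hyp
        by (rule hyp_ode_unique) (simp_all add: reg_hyp_nth that)
      thus ?thesis by simp
    qed
  qed
qed

text \<open>
  Gauss's quadratic transformation, again for all parameters. In the proof \<open>c = a + b + 1/2\<close> is the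
  free variable and \<open>b\<close> depends on it.
\<close>

lemma reg_hyp_quadratic:
  "reg_hyp a b (a + b + 1/2) oo (4 * fps_X * (1 - fps_X)) = reg_hyp (2 * a) (2 * b) (a + b + 1/2)"
proof (rule fps_ext)
  fix k
  let ?L = "\<lambda>c. (reg_hyp a (c - a - 1/2) c oo (4 * fps_X * (1 - fps_X))) $ k"
  let ?R = "\<lambda>c. reg_hyp (2 * a) (2 * (c - a - 1/2)) c $ k"
  have "?L (a + b + 1/2) = ?R (a + b + 1/2)"
  proof (rule eq_if_eq_off_nonpos_Ints[of ?L ?R])
    show "continuous_on UNIV ?L"
      unfolding fps_compose_nth reg_hyp_nth by (intro continuous_intros continuous_on_rGamma'; simp)
    show "continuous_on UNIV ?R"
      unfolding reg_hyp_nth by (intro continuous_intros continuous_on_rGamma'; simp)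
    show "?L c = ?R c" if c: "c \<notin> \<int>\<^sub>\<le>\<^sub>0" for c
    proof -
      define b where "b = c - a - 1/2"
      have c_eq: "c = a + b + 1/2" by (simp add: b_def)
      have "reg_hyp a b c oo (4 * fps_X * (1 - fps_X)) = reg_hyp (2 * a) (2 * b) c"
        using hyp_ode_quadratic[OF hyp_ode_reg_hyp[of a b "a + b + 1/2"], folded c_eq] hyp_ode_reg_hyp
        by (rule hyp_ode_unique) (simp_all add: reg_hyp_nth c)
      thus ?thesis by (simp add: b_def)
    qed
  qed
  thus "(reg_hyp a b (a + b + 1/2) oo (4 * fps_X * (1 - fps_X))) $ k = reg_hyp (2 * a) (2 * b) (a + b + 1/2) $ k"
    by simp
qed


section \<open>Evaluation of the series\<close>

lemma reg_hyp_neg_of_nat: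
  "reg_hyp (- of_nat n) b c = fps_of_poly (\<Sum>k\<le>n. monom (reg_hyp (- of_nat n) b c $ k) k)"
proof (rule fps_ext)
  fix m
  have "reg_hyp (- of_nat n) b c $ m = 0" if "m > n"
    using that by (simp add: reg_hyp_nth pochhammer_of_nat_eq_0_iff)
  thus "reg_hyp (- of_nat n) b c $ m =
        fps_of_poly (\<Sum>k\<le>n. monom (reg_hyp (- of_nat n) b c $ k) k) $ m"
    by (auto simp: coeff_sum not_le)
qed

text \<open>
  If \<open>a = -n\<close>, both sides of the quadratic transformation are polynomials, so that it may be
  evaluated at every complex \<open>z\<close>.
\<close>

lemma reg_hyp_quadratic_poly:
  fixes n :: nat and b :: complex
  defines "c \<equiv> - of_nat n + b + 1/2"
  shows fps_conv_radius_reg_hyp_even: "fps_conv_radius (reg_hyp (2 * - of_nat n) (2 * b) c) = \<infinity>"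
    and eval_reg_hyp_quadratic:
      "eval_fps (reg_hyp (2 * - of_nat n) (2 * b) c) z =
         (\<Sum>k\<le>n. reg_hyp (- of_nat n) b c $ k * (4 * z * (1 - z)) ^ k)"
proof -
  define p where "p = (\<Sum>k\<le>n. monom (reg_hyp (- of_nat n) b c $ k) k)"
  define q :: "complex poly" where "q = [:0, 4, -4:]"
  have q: "fps_of_poly q = 4 * fps_X * (1 - fps_X)"
    by (simp add: q_def fps_of_poly_pCons algebra_simps numeral_fps_const)
  have "reg_hyp (2 * - of_nat n) (2 * b) c = fps_of_poly p oo fps_of_poly q"
    using reg_hyp_quadratic[of "- of_nat n" b] reg_hyp_neg_of_nat[of n b c]
    by (simp add: c_def p_def q)
  hence eq: "reg_hyp (2 * - of_nat n) (2 * b) c = fps_of_poly (pcompose p q)"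
    by (simp add: fps_of_poly_pcompose q_def)
  show "fps_conv_radius (reg_hyp (2 * - of_nat n) (2 * b) c) = \<infinity>"
    by (simp only: eq fps_conv_radius_fps_of_poly)
  show "eval_fps (reg_hyp (2 * - of_nat n) (2 * b) c) z =
         (\<Sum>k\<le>n. reg_hyp (- of_nat n) b c $ k * (4 * z * (1 - z)) ^ k)"
    unfolding eq eval_fps_of_poly
    by (simp add: poly_pcompose p_def q_def poly_sum poly_monom algebra_simps)
qed

lemma one_minus_powr_series:
  fixes e :: complex
  shows fps_conv_radius_one_minus_powr: "fps_conv_radius (fps_binomial e oo (- fps_X)) \<ge> 1"
    and eval_fps_one_minus_powr:
      "norm z < 1 \<Longrightarrow> eval_fps (fps_binomial e oo (- fps_X)) z = (1 - z) powr e"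
proof -
  have eq: "fps_binomial e oo (- fps_X) = Abs_fps (\<lambda>k. (-1) ^ k * (e gchoose k))"
    by (simp add: fps_compose_uminus' fps_eq_iff)
  show "fps_conv_radius (fps_binomial e oo (- fps_X)) \<ge> 1"
    by (simp add: eq fps_conv_radius_def conv_radius_mult_power conv_radius_gchoose one_ereal_def)
  show "eval_fps (fps_binomial e oo (- fps_X)) z = (1 - z) powr e" if "norm z < 1"
    using eval_fps_binomial[of "- z" e] that
    by (simp add: eq eval_fps_def power_minus[of z] mult_ac)
qed


section \<open>Jacobi polynomials and Ferrers functions\<close>

text \<open>
  The assumption makes \<open>\<Gamma>(\<alpha> + n + 1)\<close> finite; \<open>\<alpha> + 1\<close> itself may be a nonpositive integer.
\<close>

lemma jacobi_P_eq_reg_hyp: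
  assumes "\<alpha> + of_nat n + 1 \<notin> \<int>\<^sub>\<le>\<^sub>0"
  shows "jacobi_P n \<alpha> \<beta> y = Gamma (\<alpha> + of_nat n + 1) / fact n *
    (\<Sum>k\<le>n. reg_hyp (- of_nat n) (of_nat n + \<alpha> + \<beta> + 1) (\<alpha> + 1) $ k * ((1 - y) / 2) ^ k)"
  unfolding jacobi_P_eq_sum sum_distrib_left
proof (rule sum.cong)
  fix k assume "k \<in> {..n}"
  hence "rGamma (\<alpha> + 1 + of_nat k) = pochhammer (\<alpha> + 1 + of_nat k) (n - k) * rGamma (\<alpha> + of_nat n + 1)"
    using pochhammer_rGamma[of "\<alpha> + 1 + of_nat k" "n - k"] by (simp add: of_nat_diff add_ac)
  moreover have "rGamma (\<alpha> + of_nat n + 1) * Gamma (\<alpha> + of_nat n + 1) = 1"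
    using assms by (simp add: rGamma_inverse_Gamma Gamma_eq_zero_iff)
  ultimately have "pochhammer (\<alpha> + 1 + of_nat k) (n - k) =
      Gamma (\<alpha> + of_nat n + 1) * rGamma (\<alpha> + 1 + of_nat k)"
    by (simp add: mult_ac)
  thus "pochhammer (- of_nat n) k * pochhammer (of_nat n + \<alpha> + \<beta> + 1) k *
            pochhammer (\<alpha> + 1 + of_nat k) (n - k) / (fact n * fact k) * ((1 - y) / 2) ^ k =
        Gamma (\<alpha> + of_nat n + 1) / fact n *
        (reg_hyp (- of_nat n) (of_nat n + \<alpha> + \<beta> + 1) (\<alpha> + 1) $ k * ((1 - y) / 2) ^ k)"
    by (simp add: reg_hyp_nth)
qed simp

lemma ferrers_P_eq_reg_hyp:
  "ferrers_P \<nu> (- \<mu>) x = of_real ((1 - x) / (1 + x)) powr (\<mu> / 2) *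
     eval_fps (reg_hyp (- \<nu>) (\<nu> + 1) (\<mu> + 1)) (of_real ((1 - x) / 2))"
  by (simp add: ferrers_P_def eval_fps_def reg_hyp_nth)

lemma powr_factors:
  fixes x :: real and \<mu> :: complex
  assumes "-1 < x" "x < 1"
  shows "2 powr \<mu> * (of_real ((1 - x) / (1 + x)) powr (\<mu> / 2) * of_real ((1 + x) / 2) powr \<mu>) =
    of_real (1 - x\<^sup>2) powr (\<mu> / 2)"
proof -
  have powr: "complex_of_real r powr s = exp (s * of_real (ln r))" if "r > 0" for r s
    using that by (simp add: powr_def Ln_of_real)
  have "1 - x\<^sup>2 = (1 - x) * (1 + x)"
    by (simp add: algebra_simps power2_eq_square)
  hence ln: "ln (1 - x\<^sup>2) = ln (1 - x) + ln (1 + x)" and "1 - x\<^sup>2 > 0"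
    using assms by (simp_all add: ln_mult)
  have 1: "(2 :: complex) powr \<mu> = exp (\<mu> * of_real (ln 2))"
    using powr[of 2 \<mu>] by simp
  have 2: "complex_of_real ((1 - x) / (1 + x)) powr (\<mu> / 2) = exp (\<mu> / 2 * of_real (ln (1 - x) - ln (1 + x)))"
    using assms powr[of "(1 - x) / (1 + x)" "\<mu> / 2"] by (simp only: ln_div) simp
  have 3: "complex_of_real ((1 + x) / 2) powr \<mu> = exp (\<mu> * of_real (ln (1 + x) - ln 2))"
    using assms powr[of "(1 + x) / 2" \<mu>] by (simp only: ln_div) simp
  have "2 powr \<mu> * (of_real ((1 - x) / (1 + x)) powr (\<mu> / 2) * of_real ((1 + x) / 2) powr \<mu>) =
    exp (\<mu> * of_real (ln 2) + (\<mu> / 2 * of_real (ln (1 - x) - ln (1 + x)) + \<mu> * of_real (ln (1 + x) - ln 2)))"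
    unfolding 1 2 3 exp_add ..
  also have "\<dots> = of_real (1 - x\<^sup>2) powr (\<mu> / 2)"
    unfolding powr[OF \<open>1 - x\<^sup>2 > 0\<close>] ln by (simp add: field_simps)
  finally show ?thesis by simp
qed

theorem corollary1p5:
  fixes n :: nat and lam :: complex and x :: real
  assumes "lam + of_nat n + 1 \<notin> \<int>\<^sub>\<le>\<^sub>0"
    and "x \<in> {-1<..<1}"
  shows "jacobi_P n lam (-1/2) (of_real (2 * x\<^sup>2 - 1)) =
    2 powr lam * Gamma (lam + of_nat n + 1) / (fact n * of_real (1 - x\<^sup>2) powr (lam / 2)) *
    ferrers_P (2 * of_nat n + lam) (- lam) x"
proof -
  define z where "z = complex_of_real ((1 - x) / 2)"
  define b where "b = of_nat n + lam + 1/2"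
  define S where "S = (\<Sum>k\<le>n. reg_hyp (- of_nat n) b (lam + 1) $ k * (4 * z * (1 - z)) ^ k)"
  have z: "norm z < 1" "1 - z = of_real ((1 + x) / 2)" "4 * z * (1 - z) = of_real (1 - x\<^sup>2)"
  proof -
    show "norm z < 1"
      using assms(2) unfolding z_def norm_of_real by simp
    show 1: "1 - z = of_real ((1 + x) / 2)"
      by (simp add: z_def field_simps)
    show "4 * z * (1 - z) = of_real (1 - x\<^sup>2)"
      unfolding 1 by (simp add: z_def field_simps power2_eq_square)
  qed
  have c: "lam + 1 = - of_nat n + b + 1/2"
    by (simp add: b_def)
  have jacobi: "jacobi_P n lam (-1/2) (of_real (2 * x\<^sup>2 - 1)) = Gamma (lam + of_nat n + 1) / fact n * S"
  proof -
    have "(1 - complex_of_real (2 * x\<^sup>2 - 1)) / 2 = 4 * z * (1 - z)"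
      unfolding z(3) by (simp add: field_simps)
    moreover have "of_nat n + lam + -1/2 + 1 = b"
      by (simp add: b_def)
    ultimately show ?thesis
      unfolding jacobi_P_eq_reg_hyp[OF assms(1)] S_def by (simp only:)
  qed
  \<comment> \<open>Euler's transformation with first parameters \<open>2b = 2n + 2\<lambda> + 1\<close> and \<open>-2n\<close>: the exponent is
    \<open>2b - 2n - (\<lambda> + 1) = \<lambda>\<close>, and the new parameters are \<open>\<lambda> + 1 - 2b = -2n - \<lambda>\<close> and
    \<open>\<lambda> + 1 + 2n\<close>.\<close>
  have "reg_hyp (- (2 * of_nat n + lam)) (2 * of_nat n + lam + 1) (lam + 1) =
      (fps_binomial lam oo (- fps_X)) * reg_hyp (2 * - of_nat n) (2 * b) (lam + 1)"
    using reg_hyp_Euler[of "2 * b" "2 * - of_nat n" "lam + 1"]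
    by (simp add: b_def reg_hyp_commute algebra_simps)
  moreover have "norm z < fps_conv_radius (fps_binomial lam oo (- fps_X))"
    using z(1) by (intro less_le_trans[OF _ fps_conv_radius_one_minus_powr]) simp
  moreover have "fps_conv_radius (reg_hyp (2 * - of_nat n) (2 * b) (lam + 1)) = \<infinity>"
    unfolding c by (rule fps_conv_radius_reg_hyp_even)
  moreover have "eval_fps (reg_hyp (2 * - of_nat n) (2 * b) (lam + 1)) z = S"
    unfolding S_def unfolding c by (rule eval_reg_hyp_quadratic)
  ultimately have "eval_fps (reg_hyp (- (2 * of_nat n + lam)) (2 * of_nat n + lam + 1) (lam + 1)) z =
      (1 - z) powr lam * S"
    using z(1) by (simp add: eval_fps_mult eval_fps_one_minus_powr)
  hence "2 powr lam * ferrers_P (2 * of_nat n + lam) (- lam) x =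
      of_real (1 - x\<^sup>2) powr (lam / 2) * S"
    using assms(2) powr_factors[of x lam, symmetric] unfolding ferrers_P_eq_reg_hyp z_def[symmetric] z(2)
    by (simp only: greaterThanLessThan_iff simp_thms mult_ac)
  moreover have "complex_of_real (1 - x\<^sup>2) powr (lam / 2) \<noteq> 0"
    using assms(2) by (auto simp: powr_def abs_square_eq_1 square_le_1 power2_eq_1_iff simp flip: of_real_power)
  ultimately show ?thesis
    unfolding jacobi by (simp add: field_simps)
qed

end
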